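(* Let $d,\eta,p\ge 1$ be integers with $e:=\eta p\geq 2$. For $\ell\in\{0,\dots,d-1\}$ and $i\in\{0,\dots,e-1\}$ let $w^{(\ell)}_i\in\{0,\dots,p\}$ be an integer and set $v^{(\ell)}_i := w^{(\ell)}_i/p$ and $v^{(\ell)} := (v^{(\ell)}_0,\dots,v^{(\ell)}_{e-1})$. Let $V$ be the $d\times e$ matrix with rows $v^{(0)},\dots,v^{(d-1)}$, written blockwise as $V=(V^{[0]}\ \cdots\ V^{[\eta-1]})$ with $\eta$ consecutive blocks of size $d\times p$. Assume that $|v^{(\ell)}|\in\mathbb{N}$ for all $\ell\in\{0,\dots,d-1\}$ and that $|V^{[i]}|\in\mathbb{N}$ for all $i\in\{0,\dots,\eta-1\}$. Then there exist vectors $\epsilon^{j(\ell)}\in\{0,1\}^e$, for $j\in\{0,\dots,p-1\}$ and $\ell\in\{0,\dots,d-1\}$, such that \[ v^{(\ell)}=\frac1p\sum_{j=0}^{p-1}\epsilon^{j(\ell)}\quad\text{for all }\ell\in\{0,\dots,d-1\}, \] \[ |\epsilon^{j(\ell)}|=|v^{(\ell)}|\quad\text{for all } j\in\{0,\dots,p-1\},\ \ell\in\{0,\dots,d-1\}, \] \[ |E^{j[i]}|=|V^{[i]}|\quad\text{for all } j\in\{0,\dots,p-1\},\ i\in\{0,\dots,\eta-1\}, \] where $E^j$ is the $d\times e$ matrix with rows $\epsilon^{j(0)},\dots,\epsilon^{j(d-1)}$ and $E^j=(E^{j[0]}\ \cdots\ E^{j[\eta-1]})$ is its decomposition into $\eta$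 consecutive blocks of size $d\times p$.
   Context: For a vector or a matrix $X$ with real entries, $|X|$ denotes the sum of its entries (not of absolute values). $\mathbb{N}$ is the set of non-negative integers. Explicitly, the block with index $i\in\{0,\dots,\eta-1\}$ of a $d\times e$ matrix consists of the columns $ip, ip+1,\dots, ip+p-1$ (columns indexed by $0,\dots,e-1$). *)

theory Defs
  imports "Jordan_Normal_Form.Matrix"
begin

text \<open>The sum of the entries of a vector; its analogue for matrices is \<^const>\<open>sum_mat\<close>.\<close>

definition entry_sum :: "'a :: comm_monoid_add vec \<Rightarrow> 'a" where
  "entry_sum x = (\<Sum>i = 0..<dim_vec x. x $ i)"

text \<open>Block \<open>i\<close> (counted from \<open>0\<close>) of a matrix split into consecutive blocks of \<open>p\<close> columns.
  It is meaningful only if \<open>(i + 1) * p\<close> is at most the number of columns.\<close>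

definition col_block :: "nat \<Rightarrow> nat \<Rightarrow> 'a mat \<Rightarrow> 'a mat" where
  "col_block p i A = mat (dim_row A) p (\<lambda>(l, c). A $$ (l, i * p + c))"

end

theory Submission
  imports Defs
begin

text \<open>
  The theorem is a statement about cells carrying two labels. A cell \<open>(l, k)\<close> of the matrix lies
  in row \<open>l\<close> and in block \<open>k div p\<close>; the row sums and block sums are the two families of
  marginals, that is, sums over all cells with a given label. Each cell belongs to exactly one row
  and one block, so the cells are the edges of a bipartite multigraph between rows and blocks, and
  the theorem is an integrality property of such graphs: if a vector indexed by the edges has integral
  marginals and its entries are multiples of \<open>1/p\<close> in \<open>[0,1]\<close>, then it is an average of
  \<open>p\<close> vectors with entries \<open>0\<close> and \<open>1\<close> that have the same marginals.

  The layers are split off one at a time (\<open>split_into_binary_layers\<close>). Given weights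
  \<open>w \<le> p\<close> with marginals \<open>p r\<close> and \<open>p c\<close>, round \<open>w / p\<close> to a 0/1 vector \<open>u\<close>
  with marginals \<open>r\<close> and \<open>c\<close>, leaving entries equal to \<open>0\<close> or \<open>1\<close> unchanged. This
  last property makes \<open>0 \<le> w - u \<le> p - 1\<close>, so \<open>w - u\<close> is a datum of the same kind for
  \<open>p - 1\<close>.

  The rounding (\<open>round_preserving_marginals\<close>) moves the fractional entries along a nonzero
  direction with zero marginals until one of them hits \<open>0\<close> or \<open>1\<close>, and repeats. Such a
  direction, classically an alternating sign pattern on a cycle, exists because an integral
  marginal cannot contain exactly one fractional entry: every label that occurs on a fractional
  cell occurs at least twice, so there are at most as many labels as fractional cells, and the
  marginal equations satisfy one linear relation, since both families of marginals add up to the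
  same total. Hence there are more unknowns than independent equations
  (\<open>zero_marginals_nontrivial\<close>).
\<close>

section \<open>Nonzero vectors with zero marginals\<close>

text \<open>Gaussian elimination: solve one equation for an unknown that occurs in it, and substitute
  the result into the others.\<close>
lemma homogeneous_system_nontrivial_solution:
  fixes c :: "'q \<Rightarrow> 's \<Rightarrow> 'k :: field"
  assumes "finite E" "finite F" "card E < card F"
  shows "\<exists>x. (\<exists>s\<in>F. x s \<noteq> 0) \<and> (\<forall>q\<in>E. (\<Sum>s\<in>F. c q s * x s) = 0)"
  using assms
proof (induction E arbitrary: F c rule: finite_induct)
  case empty
  then have "F \<noteq> {}" by auto
  then show ?case by (auto intro!: exI[of _ "\<lambda>_. 1"])
next
  case (insert q E)
  show ?case
  proof (cases "\<forall>s\<in>F. c q s = 0")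
    case True
    have "card E < card F" using insert by simp
    from insert.IH[OF \<open>finite F\<close> this, of c] True show ?thesis by auto
  next
    case False
    then obtain t where t: "t \<in> F" "c q t \<noteq> 0" by auto
    define F' where "F' = F - {t}"
    define c' where "c' r s = c r s - c r t * c q s / c q t" for r s
    have "card E < card F'" "finite F'" "t \<notin> F'"
      using insert t by (auto simp: F'_def)
    from insert.IH[OF this(2,1), of c'] obtain y where
      y: "\<exists>s\<in>F'. y s \<noteq> 0" "\<And>r. r \<in> E \<Longrightarrow> (\<Sum>s\<in>F'. c' r s * y s) = 0" by auto
    define z where "z = - (\<Sum>s\<in>F'. c q s * y s) / c q t"
    define x where "x = y(t := z)"
    have split: "(\<Sum>s\<in>F. c r s * x s) = c r t * z + (\<Sum>s\<in>F'. c r s * y s)" for r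
    proof -
      have "(\<Sum>s\<in>F'. c r s * x s) = (\<Sum>s\<in>F'. c r s * y s)"
        using \<open>t \<notin> F'\<close> by (intro sum.cong) (auto simp: x_def)
      then show ?thesis
        using t \<open>finite F\<close> by (simp add: sum.remove[of F t] F'_def x_def)
    qed
    have "(\<Sum>s\<in>F. c q s * x s) = 0"
      using t by (simp add: split z_def)
    moreover have "(\<Sum>s\<in>F. c r s * x s) = 0" if "r \<in> E" for r
    proof -
      have "(\<Sum>s\<in>F'. c' r s * y s)
          = (\<Sum>s\<in>F'. c r s * y s) - c r t / c q t * (\<Sum>s\<in>F'. c q s * y s)"
        by (simp add: c'_def algebra_simps sum_subtractf sum_distrib_left)
      with y(2)[OF that] show ?thesis by (simp add: split z_def)
    qed
    moreover have "\<exists>s\<in>F. x s \<noteq> 0"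
      using y(1) \<open>t \<notin> F'\<close> by (auto simp: x_def F'_def)
    ultimately show ?thesis by blast
  qed
qed

text \<open>Applied to both labellings of a bipartite multigraph, this gives that a graph without isolated
  vertices and leaves has no more vertices than edges.\<close>

lemma card_image_le_half:
  assumes "finite F" "\<And>s. s \<in> F \<Longrightarrow> \<exists>t\<in>F. t \<noteq> s \<and> f t = f s"
  shows "2 * card (f ` F) \<le> card F"
proof -
  have "2 \<le> card {s \<in> F. f s = a}" if "a \<in> f ` F" for a
  proof -
    from that obtain s where "s \<in> F" "f s = a" by auto
    with assms(2) obtain t where "t \<in> F" "t \<noteq> s" "f t = a" by metis
    have "card {s, t} \<le> card {s \<in> F. f s = a}"
      using \<open>s \<in> F\<close> \<open>f s = a\<close> \<open>t \<in> F\<close> \<open>f t = a\<close> assms(1) by (intro card_mono) auto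
    with \<open>t \<noteq> s\<close> show ?thesis by simp
  qed
  then have "(\<Sum>a\<in>f ` F. 2) \<le> (\<Sum>a\<in>f ` F. card {s \<in> F. f s = a})"
    by (intro sum_mono)
  also have "\<dots> = card F"
    using sum.image_gen[OF assms(1), of "\<lambda>_. 1::nat" f] by simp
  finally show ?thesis by simp
qed

text \<open>The hypotheses say that every occurring label occurs at least twice. Counting then gives only
  that there are at least as many unknowns as equations; the missing one is gained by discarding
  the equation of a single label of the first kind, which follows from the others because the sum
  over all cells can be computed with either labelling.\<close>

lemma zero_marginals_nontrivial:
  fixes f :: "'s \<Rightarrow> 'a" and g :: "'s \<Rightarrow> 'b"
  assumes fin: "finite F" and "F \<noteq> {}"
    and f: "\<And>s. s \<in> F \<Longrightarrow> \<exists>t\<in>F. t \<noteq> s \<and> f t = f s"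
    and g: "\<And>s. s \<in> F \<Longrightarrow> \<exists>t\<in>F. t \<noteq> s \<and> g t = g s"
  shows "\<exists>x :: 's \<Rightarrow> 'k :: field. (\<exists>s\<in>F. x s \<noteq> 0) \<and>
           (\<forall>a. (\<Sum>s | s \<in> F \<and> f s = a. x s) = 0) \<and>
           (\<forall>b. (\<Sum>s | s \<in> F \<and> g s = b. x s) = 0)"
proof -
  obtain s0 where s0: "s0 \<in> F" using \<open>F \<noteq> {}\<close> by auto
  define A where "A = f ` F - {f s0}"
  define E where "E = A <+> g ` F"
  define c :: "'a + 'b \<Rightarrow> 's \<Rightarrow> 'k"
    where "c q s = of_bool (case q of Inl a \<Rightarrow> f s = a | Inr b \<Rightarrow> g s = b)" for q s
  have c: "(\<Sum>s\<in>F. c (Inl a) s * x s) = (\<Sum>s | s \<in> F \<and> f s = a. x s)"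
    "(\<Sum>s\<in>F. c (Inr b) s * x s) = (\<Sum>s | s \<in> F \<and> g s = b. x s)" for a b x
    by (rule sum.mono_neutral_cong_right; use fin in \<open>auto simp: c_def\<close>)+
  have "card E = card A + card (g ` F)"
    using fin by (simp add: E_def A_def card_Plus)
  also have "\<dots> < card (f ` F) + card (g ` F)"
  proof -
    have "card A < card (f ` F)"
      unfolding A_def using fin s0 by (intro card_Diff1_less) auto
    then show ?thesis by simp
  qed
  also have "\<dots> \<le> card F"
    using card_image_le_half[OF fin f] card_image_le_half[OF fin g] by simp
  finally have "card E < card F" .
  moreover have "finite E" using fin by (simp add: E_def A_def)
  ultimately obtain x where x: "\<exists>s\<in>F. x s \<noteq> 0" "\<And>q. q \<in> E \<Longrightarrow> (\<Sum>s\<in>F. c q s * x s) = 0"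
    using homogeneous_system_nontrivial_solution[of E F c] fin by blast
  have outside: "(\<Sum>s | s \<in> F \<and> h s = a. x s) = 0" if "a \<notin> h ` F" for h :: "'s \<Rightarrow> 'z" and a
    using that by (intro sum.neutral) auto
  have gx: "(\<Sum>s | s \<in> F \<and> g s = b. x s) = 0" for b
    using x(2)[of "Inr b"] c(2)[where x = x] outside[of b g] by (cases "b \<in> g ` F") (auto simp: E_def)
  have fA: "(\<Sum>s | s \<in> F \<and> f s = a. x s) = 0" if "a \<noteq> f s0" for a
    using x(2)[of "Inl a"] c(1)[where x = x] outside[of a f] that
    by (cases "a \<in> f ` F") (auto simp: E_def A_def)
  \<comment> \<open>The discarded equation: all other marginals of \<open>f\<close> vanish, and so does the total.\<close>
  have "(\<Sum>s | s \<in> F \<and> f s = f s0. x s)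
      = (\<Sum>a\<in>f ` F. \<Sum>s | s \<in> F \<and> f s = a. x s)"
    using fin s0 fA by (subst sum.remove[of _ "f s0"]) (auto intro!: sum.neutral)
  also have "\<dots> = (\<Sum>b\<in>g ` F. \<Sum>s | s \<in> F \<and> g s = b. x s)"
    by (simp flip: sum.image_gen[OF fin])
  also have "\<dots> = 0" by (simp add: gx)
  finally have "(\<Sum>s | s \<in> F \<and> f s = a. x s) = 0" for a
    using fA[of a] by (cases "a = f s0") auto
  with gx x(1) show ?thesis by blast
qed

section \<open>Rounding with prescribed marginals\<close>

text \<open>If all other entries of a marginal were \<open>0\<close> or \<open>1\<close>, then the entry at \<open>s\<close> would be
  a difference of integers, strictly between \<open>0\<close> and \<open>1\<close>.\<close>

lemma another_fractional_cell:
  fixes v :: "'s \<Rightarrow> real"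
  assumes "finite S" "\<And>s. s \<in> S \<Longrightarrow> 0 \<le> v s \<and> v s \<le> 1"
    and "(\<Sum>t | t \<in> S \<and> f t = f s. v t) \<in> \<int>"
    and s: "s \<in> S" "v s \<noteq> 0" "v s \<noteq> 1"
  shows "\<exists>t\<in>S. v t \<noteq> 0 \<and> v t \<noteq> 1 \<and> t \<noteq> s \<and> f t = f s"
proof (rule ccontr)
  assume alone: "\<not> ?thesis"
  define T where "T = {t \<in> S. f t = f s}"
  have "v t \<in> \<int>" if "t \<in> T - {s}" for t
  proof -
    have "v t = 0 \<or> v t = 1" using alone that by (auto simp: T_def)
    then show ?thesis by auto
  qed
  then have "(\<Sum>t\<in>T - {s}. v t) \<in> \<int>" by (rule Ints_sum)
  moreover have "(\<Sum>t\<in>T. v t) = v s + (\<Sum>t\<in>T - {s}. v t)"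
    using assms(1) s by (intro sum.remove) (auto simp: T_def)
  ultimately have "v s \<in> \<int>"
    using Ints_diff[of "\<Sum>t\<in>T. v t" "\<Sum>t\<in>T - {s}. v t"] assms(3) by (simp add: T_def)
  then obtain n where "v s = of_int n" by (elim Ints_cases)
  with assms(2)[OF s(1)] s(2,3) have "0 < n" "n < 1" by auto
  then show False by simp
qed

text \<open>Walking from an interior point of a cube in a nonzero direction, the first time at which some
  coordinate reaches a face is the minimum of the exit times of the individual coordinates.\<close>

lemma step_to_boundary:
  fixes v x :: "'s \<Rightarrow> real"
  assumes "finite F" "\<And>s. s \<in> F \<Longrightarrow> 0 < v s \<and> v s < 1" "\<exists>s\<in>F. x s \<noteq> 0"
  shows "\<exists>\<tau>. (\<forall>s\<in>F. 0 \<le> v s + \<tau> * x s \<and> v s + \<tau> * x s \<le> 1) \<and>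
             (\<exists>s\<in>F. v s + \<tau> * x s \<in> {0, 1})"
proof -
  define F' where "F' = {s \<in> F. x s \<noteq> 0}"
  \<comment> \<open>The time at which coordinate \<open>s\<close> leaves the interval, through \<open>1\<close> if it grows and
    through \<open>0\<close> if it decreases.\<close>
  define h where "h s = (if x s > 0 then (1 - v s) / x s else - v s / x s)" for s
  have F': "finite F'" "F' \<noteq> {}" using assms(1,3) by (auto simp: F'_def)
  then have "Min (h ` F') \<in> h ` F'" by (intro Min_in) auto
  then obtain m where m: "m \<in> F'" "h m = Min (h ` F')" by (elim imageE) simp
  have h_pos: "0 < h s" if "s \<in> F'" for s
    using assms(2)[of s] that by (auto simp: h_def F'_def field_simps)
  have "0 \<le> v s + h m * x s \<and> v s + h m * x s \<le> 1" if "s \<in> F" for s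
  proof (cases "x s = 0")
    case True
    then show ?thesis using assms(2)[OF that] by simp
  next
    case False
    with that have "s \<in> F'" by (simp add: F'_def)
    then have le: "h m \<le> h s" using F' m by simp
    have "0 < h m" using h_pos m(1) .
    show ?thesis
    proof (cases "x s > 0")
      case True
      then have "h m * x s \<le> 1 - v s" using le by (simp add: h_def field_simps)
      moreover have "0 \<le> h m * x s" using True \<open>0 < h m\<close> by simp
      ultimately show ?thesis using assms(2)[OF that] by linarith
    next
      case neg: False
      with False have "x s < 0" by simp
      then have "- v s \<le> h m * x s" using le neg by (simp add: h_def field_simps)
      moreover have "h m * x s \<le> 0"
        using \<open>x s < 0\<close> \<open>0 < h m\<close> by (simp add: mult_nonneg_nonpos)
      ultimately show ?thesis using assms(2)[OF that] by linarith
    qed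
  qed
  moreover have "m \<in> F" "v m + h m * x m \<in> {0, 1}"
    using m(1) by (auto simp: F'_def h_def)
  ultimately show ?thesis by blast
qed

text \<open>Induction on the number of fractional entries. Entries that are already \<open>0\<close> or \<open>1\<close>
  are never moved; besides making the induction work, this is what allows the rounded vector to be
  subtracted from the original weights later.\<close>

lemma round_preserving_marginals:
  fixes v :: "'s \<Rightarrow> real" and f :: "'s \<Rightarrow> 'a" and g :: "'s \<Rightarrow> 'b"
  assumes fin: "finite S" and "\<And>s. s \<in> S \<Longrightarrow> 0 \<le> v s \<and> v s \<le> 1"
    and "\<And>a. (\<Sum>s | s \<in> S \<and> f s = a. v s) \<in> \<int>"
    and "\<And>b. (\<Sum>s | s \<in> S \<and> g s = b. v s) \<in> \<int>"
  shows "\<exists>u. (\<forall>s\<in>S. u s \<in> {0, 1} \<and> (v s \<in> {0, 1} \<longrightarrow> u s = v s)) \<and>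
             (\<forall>a. (\<Sum>s | s \<in> S \<and> f s = a. u s) = (\<Sum>s | s \<in> S \<and> f s = a. v s)) \<and>
             (\<forall>b. (\<Sum>s | s \<in> S \<and> g s = b. u s) = (\<Sum>s | s \<in> S \<and> g s = b. v s))"
  using assms(2-)
proof (induction "card {s \<in> S. v s \<notin> {0, 1}}" arbitrary: v rule: less_induct)
  case less
  define F where "F = {s \<in> S. v s \<notin> {0, 1}}"
  have "finite F" using fin by (simp add: F_def)
  show ?case
  proof (cases "F = {}")
    case True
    then have "\<forall>s\<in>S. v s \<in> {0, 1}" by (auto simp: F_def)
    then show ?thesis by (intro exI[of _ v]) auto
  next
    case False
    have f_mate: "\<exists>t\<in>F. t \<noteq> s \<and> f t = f s" and g_mate: "\<exists>t\<in>F. t \<noteq> s \<and> g t = g s"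
      if "s \<in> F" for s
      using another_fractional_cell[OF fin less.prems(1,2), of s]
        another_fractional_cell[OF fin less.prems(1,3), of s] that
      by (auto simp: F_def)
    obtain x :: "'s \<Rightarrow> real" where x: "\<exists>s\<in>F. x s \<noteq> 0"
      "\<And>a. (\<Sum>s | s \<in> F \<and> f s = a. x s) = 0"
      "\<And>b. (\<Sum>s | s \<in> F \<and> g s = b. x s) = 0"
      using zero_marginals_nontrivial[OF \<open>finite F\<close> False f_mate g_mate] by blast
    have frac: "0 < v s \<and> v s < 1" if "s \<in> F" for s
      using less.prems(1)[of s] that by (auto simp: F_def)
    obtain \<tau> where \<tau>: "\<And>s. s \<in> F \<Longrightarrow> 0 \<le> v s + \<tau> * x s \<and> v s + \<tau> * x s \<le> 1"
      "\<exists>s\<in>F. v s + \<tau> * x s \<in> {0, 1}"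
      using step_to_boundary[OF \<open>finite F\<close>, of v x] frac x(1) by blast
    define v' where "v' s = v s + (if s \<in> F then \<tau> * x s else 0)" for s
    have marginals: "(\<Sum>s | s \<in> S \<and> h s = a. v' s) = (\<Sum>s | s \<in> S \<and> h s = a. v s)"
      if "(\<Sum>s | s \<in> F \<and> h s = a. x s) = 0" for h :: "'s \<Rightarrow> 'z" and a
    proof -
      have "(\<Sum>s | s \<in> S \<and> h s = a. if s \<in> F then \<tau> * x s else 0)
          = (\<Sum>s | s \<in> F \<and> h s = a. \<tau> * x s)"
        using fin by (intro sum.mono_neutral_cong_right) (auto simp: F_def)
      also have "\<dots> = 0" using that by (simp flip: sum_distrib_left)
      finally show ?thesis by (simp add: v'_def sum.distrib)
    qed
    note f_marginal = marginals[OF x(2)] and g_marginal = marginals[OF x(3)]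
    have kept: "v' s = v s" if "s \<in> S" "v s \<in> {0, 1}" for s
      using that by (auto simp: v'_def F_def)
    have bounds: "0 \<le> v' s \<and> v' s \<le> 1" if "s \<in> S" for s
      using \<tau>(1)[of s] less.prems(1)[OF that] by (auto simp: v'_def)
    have "{s \<in> S. v' s \<notin> {0, 1}} \<subset> F"
      using \<tau>(2) kept by (auto simp: F_def v'_def)
    then have "card {s \<in> S. v' s \<notin> {0, 1}} < card {s \<in> S. v s \<notin> {0, 1}}"
      using \<open>finite F\<close> unfolding F_def by (intro psubset_card_mono)
    then obtain u where
      "\<forall>s\<in>S. u s \<in> {0, 1} \<and> (v' s \<in> {0, 1} \<longrightarrow> u s = v' s)"
      "\<forall>a. (\<Sum>s | s \<in> S \<and> f s = a. u s) = (\<Sum>s | s \<in> S \<and> f s = a. v' s)"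
      "\<forall>b. (\<Sum>s | s \<in> S \<and> g s = b. u s) = (\<Sum>s | s \<in> S \<and> g s = b. v' s)"
      using less.hyps[of v'] bounds less.prems(2,3)
      unfolding f_marginal g_marginal by blast
    then show ?thesis
      using kept unfolding f_marginal g_marginal by (intro exI[of _ u]) auto
  qed
qed

section \<open>Splitting into layers\<close>

text \<open>The weights \<open>w\<close> have average \<open>w / p\<close> over \<open>p\<close> layers. A rounding of this average
  that keeps its entries \<open>0\<close> and \<open>1\<close> is used as one layer: it is \<open>0\<close> where \<open>w = 0\<close>
  and \<open>1\<close> where \<open>w = p\<close>, so the remaining weights lie between \<open>0\<close> and \<open>p - 1\<close>.\<close>

lemma split_into_binary_layers:
  fixes w :: "'s \<Rightarrow> nat" and f :: "'s \<Rightarrow> 'a" and g :: "'s \<Rightarrow> 'b"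
  assumes fin: "finite S" and "\<And>s. s \<in> S \<Longrightarrow> w s \<le> p"
    and "\<And>a. (\<Sum>s | s \<in> S \<and> f s = a. w s) = p * r a"
    and "\<And>b. (\<Sum>s | s \<in> S \<and> g s = b. w s) = p * c b"
  shows "\<exists>u :: nat \<Rightarrow> 's \<Rightarrow> nat.
           (\<forall>j<p. \<forall>s\<in>S. u j s \<in> {0, 1}) \<and> (\<forall>s\<in>S. (\<Sum>j<p. u j s) = w s) \<and>
           (\<forall>j<p. \<forall>a. (\<Sum>s | s \<in> S \<and> f s = a. u j s) = r a) \<and>
           (\<forall>j<p. \<forall>b. (\<Sum>s | s \<in> S \<and> g s = b. u j s) = c b)"
  using assms(2-)
proof (induction p arbitrary: w)
  case 0
  then show ?case by auto
next
  case (Suc p)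
  define v where "v s = real (w s) / real (Suc p)" for s
  have v_marginal: "(\<Sum>s | s \<in> S \<and> h s = a. v s) = real k"
    if "(\<Sum>s | s \<in> S \<and> h s = a. w s) = Suc p * k" for h :: "'s \<Rightarrow> 'z" and a k
  proof -
    have "(\<Sum>s | s \<in> S \<and> h s = a. v s) = real (\<Sum>s | s \<in> S \<and> h s = a. w s) / real (Suc p)"
      by (simp only: v_def of_nat_sum sum_divide_distrib)
    then show ?thesis unfolding that by (simp only: of_nat_mult) simp
  qed
  have f_marginal: "(\<Sum>s | s \<in> S \<and> f s = a. v s) = real (r a)" for a
    by (rule v_marginal[OF Suc.prems(2)])
  have g_marginal: "(\<Sum>s | s \<in> S \<and> g s = b. v s) = real (c b)" for b
    by (rule v_marginal[OF Suc.prems(3)])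
  have bounds: "0 \<le> v s \<and> v s \<le> 1" if "s \<in> S" for s
    using Suc.prems(1)[OF that] by (simp add: v_def field_simps)
  obtain y where
    y: "\<And>s. s \<in> S \<Longrightarrow> y s \<in> {0, 1}" "\<And>s. s \<in> S \<Longrightarrow> v s \<in> {0, 1} \<Longrightarrow> y s = v s"
      "\<And>a. (\<Sum>s | s \<in> S \<and> f s = a. y s) = real (r a)"
      "\<And>b. (\<Sum>s | s \<in> S \<and> g s = b. y s) = real (c b)"
  proof -
    have "\<exists>y. (\<forall>s\<in>S. y s \<in> {0, 1} \<and> (v s \<in> {0, 1} \<longrightarrow> y s = v s)) \<and>
        (\<forall>a. (\<Sum>s | s \<in> S \<and> f s = a. y s) = real (r a)) \<and>
        (\<forall>b. (\<Sum>s | s \<in> S \<and> g s = b. y s) = real (c b))"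
      using round_preserving_marginals[OF fin, of v f g, OF bounds]
      unfolding f_marginal g_marginal by simp
    then show ?thesis using that by blast
  qed
  define z where "z s = (if y s = 1 then 1 else 0 :: nat)" for s
  have z_y: "real (z s) = y s" if "s \<in> S" for s
    using y(1)[OF that] by (auto simp: z_def)
  have z_marginal: "(\<Sum>s | s \<in> S \<and> h s = a. z s) = k"
    if "(\<Sum>s | s \<in> S \<and> h s = a. y s) = real k" for h :: "'s \<Rightarrow> 'z" and a k
  proof -
    have "real (\<Sum>s | s \<in> S \<and> h s = a. z s) = real k"
      unfolding of_nat_sum that[symmetric] by (intro sum.cong) (auto simp: z_y)
    then show ?thesis by (simp only: of_nat_eq_iff)
  qed
  \<comment> \<open>The truncated difference of \<open>w\<close> and \<open>z\<close> is a true difference.\<close>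
  have z_le: "z s \<le> w s" if "s \<in> S" for s
    using y(2)[OF that] by (cases "w s = 0") (auto simp: z_def v_def)
  have rest_le: "w s - z s \<le> p" if "s \<in> S" for s
  proof (cases "w s = Suc p")
    case True
    then have "y s = 1" using y(2)[OF that] by (simp add: v_def)
    then show ?thesis using True by (simp add: z_def)
  next
    case False
    then show ?thesis using Suc.prems(1)[OF that] by simp
  qed
  have rest_marginal: "(\<Sum>s | s \<in> S \<and> h s = a. w s - z s) = p * k"
    if "(\<Sum>s | s \<in> S \<and> h s = a. w s) = Suc p * k" "(\<Sum>s | s \<in> S \<and> h s = a. z s) = k"
    for h :: "'s \<Rightarrow> 'z" and a k
    using that z_le by (subst sum_subtractf_nat) auto
  obtain u where u: "\<And>j s. j < p \<Longrightarrow> s \<in> S \<Longrightarrow> u j s \<in> {0, 1 :: nat}"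
    "\<And>s. s \<in> S \<Longrightarrow> (\<Sum>j<p. u j s) = w s - z s"
    "\<And>j a. j < p \<Longrightarrow> (\<Sum>s | s \<in> S \<and> f s = a. u j s) = r a"
    "\<And>j b. j < p \<Longrightarrow> (\<Sum>s | s \<in> S \<and> g s = b. u j s) = c b"
    using Suc.IH[OF rest_le rest_marginal[OF Suc.prems(2) z_marginal[OF y(3)]]
        rest_marginal[OF Suc.prems(3) z_marginal[OF y(4)]]] by blast
  have old: "(\<Sum>j<p. (u(p := z)) j s) = (\<Sum>j<p. u j s)" for s
    by (intro sum.cong) auto
  show ?case
    using u z_le z_marginal[OF y(3)] z_marginal[OF y(4)]
    by (intro exI[of _ "u(p := z)"]) (auto simp: less_Suc_eq old z_def)
qed

section \<open>The row and block decomposition\<close>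

theorem proposition3p14:
  fixes d \<eta> p e :: nat
    and w :: "nat \<Rightarrow> nat \<Rightarrow> int"
    and v :: "nat \<Rightarrow> real vec"
    and V :: "real mat"
  assumes "d \<ge> 1" and "\<eta> \<ge> 1" and "p \<ge> 1"
    and "e = \<eta> * p" and "e \<ge> 2"
    and "\<And>l i. l < d \<Longrightarrow> i < e \<Longrightarrow> 0 \<le> w l i \<and> w l i \<le> int p"
    and "\<And>l. l < d \<Longrightarrow> v l = vec e (\<lambda>i. real_of_int (w l i) / real p)"
    and "V = mat_of_row_fun d e v"
    and "\<And>l. l < d \<Longrightarrow> entry_sum (v l) \<in> \<nat>"
    and "\<And>i. i < \<eta> \<Longrightarrow> sum_mat (col_block p i V) \<in> \<nat>"
  shows "\<exists>\<epsilon> :: nat \<Rightarrow> nat \<Rightarrow> real vec.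
      (\<forall>j<p. \<forall>l<d. \<epsilon> j l \<in> carrier_vec e \<and> (\<forall>i<e. \<epsilon> j l $ i \<in> {0, 1})) \<and>
      (\<forall>l<d. v l = (1 / real p) \<cdot>\<^sub>v finsum_vec TYPE(real) e (\<lambda>j. \<epsilon> j l) {0..<p}) \<and>
      (\<forall>j<p. \<forall>l<d. entry_sum (\<epsilon> j l) = entry_sum (v l)) \<and>
      (\<forall>j<p. \<forall>i<\<eta>. sum_mat (col_block p i (mat_of_row_fun d e (\<epsilon> j))) = sum_mat (col_block p i V))"
proof -
  \<comment> \<open>The matrix entries become weights on cells \<open>(l, k)\<close>, labelled by row and by block.\<close>
  define S where "S = {..<d} \<times> {..<e}"
  define W where "W = (\<lambda>(l, k). nat (w l k))"
  define blk where "blk = (\<lambda>(l :: nat, k). k div p)"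
  have "p > 0" using assms(3) by simp
  have "finite S" by (simp add: S_def)
  have W_v: "v l $ k = real (W (l, k)) / real p" if "l < d" "k < e" for l k
    using assms(6)[OF that] assms(7)[OF that(1)] that by (simp add: W_def)
  have v_carrier: "v l \<in> carrier_vec e" if "l < d" for l
    using assms(7)[OF that] by simp
  have W_le: "W s \<le> p" if "s \<in> S" for s
    using that assms(6) by (fastforce simp: S_def W_def nat_le_iff)
  have row: "entry_sum x = (\<Sum>s | s \<in> S \<and> fst s = l. y s)"
    if "l < d" "x \<in> carrier_vec e" "\<And>k. k < e \<Longrightarrow> x $ k = y (l, k)" for x :: "real vec" and y l
  proof -
    have "entry_sum x = (\<Sum>k<e. y (l, k))"
      using that by (simp add: entry_sum_def lessThan_atLeast0)
    also have "\<dots> = (\<Sum>s | s \<in> S \<and> fst s = l. y s)"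
      using that(1) by (intro sum.reindex_bij_witness[of _ snd "Pair l"]) (auto simp: S_def)
    finally show ?thesis .
  qed
  have block: "sum_mat (col_block p i (mat_of_row_fun d e x)) = (\<Sum>s | s \<in> S \<and> blk s = i. y s)"
    if "i < \<eta>" "\<And>l k. l < d \<Longrightarrow> k < e \<Longrightarrow> x l $ k = y (l, k)" for x :: "nat \<Rightarrow> real vec" and y i
  proof -
    have in_range: "i * p + c < e" if "c < p" for c
    proof -
      have "i * p + c < Suc i * p" using that by simp
      also have "\<dots> \<le> \<eta> * p" using \<open>i < \<eta>\<close> by (intro mult_le_mono1) simp
      finally show ?thesis using assms(4) by simp
    qed
    have "sum_mat (col_block p i (mat_of_row_fun d e x))
        = (\<Sum>(l, c)\<in>{..<d} \<times> {..<p}. y (l, i * p + c))"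
      by (auto simp: sum_mat_def col_block_def in_range that(2) lessThan_atLeast0
          intro!: sum.cong)
    also have "\<dots> = (\<Sum>s | s \<in> S \<and> blk s = i. y s)"
      by (intro sum.reindex_bij_witness[of _ "\<lambda>(l, k). (l, k mod p)" "\<lambda>(l, c). (l, i * p + c)"])
        (use \<open>p > 0\<close> in_range in \<open>auto simp: S_def blk_def\<close>)
    finally show ?thesis .
  qed
  have dvd: "p dvd (\<Sum>s\<in>T. W s)" if "(\<Sum>s\<in>T. real (W s) / real p) \<in> \<nat>" for T
  proof -
    from that obtain n where "(\<Sum>s\<in>T. real (W s) / real p) = real n" by (auto elim: Nats_cases)
    then have "real (\<Sum>s\<in>T. W s) = real (p * n)"
      using \<open>p > 0\<close> by (simp add: field_simps flip: sum_divide_distrib)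
    then show ?thesis by (simp only: of_nat_eq_iff) simp
  qed
  have v_row: "entry_sum (v l) = (\<Sum>s | s \<in> S \<and> fst s = l. real (W s) / real p)" if "l < d" for l
    using that by (intro row) (auto simp: W_v v_carrier)
  have V_block: "sum_mat (col_block p i V) = (\<Sum>s | s \<in> S \<and> blk s = i. real (W s) / real p)"
    if "i < \<eta>" for i
    unfolding assms(8) using that by (intro block) (auto simp: W_v)
  \<comment> \<open>Labels that occur on no cell have empty marginals, so divisibility holds for all labels.\<close>
  have dvd_fst: "p dvd (\<Sum>s | s \<in> S \<and> fst s = l. W s)" for l
  proof (cases "l < d")
    case True
    then show ?thesis using assms(9)[OF True] by (intro dvd) (simp add: v_row)
  next
    case False
    then have "{s. s \<in> S \<and> fst s = l} = {}" by (auto simp: S_def)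
    then show ?thesis by (simp only: sum.empty dvd_0_right)
  qed
  define r where "r l = (\<Sum>s | s \<in> S \<and> fst s = l. W s) div p" for l
  have r: "(\<Sum>s | s \<in> S \<and> fst s = l. W s) = p * r l" for l
    unfolding r_def using dvd_fst[of l] by (simp only: dvd_mult_div_cancel)
  have dvd_blk: "p dvd (\<Sum>s | s \<in> S \<and> blk s = i. W s)" for i
  proof (cases "i < \<eta>")
    case True
    then show ?thesis using assms(10)[OF True] by (intro dvd) (simp add: V_block)
  next
    case False
    then have "{s. s \<in> S \<and> blk s = i} = {}"
      using assms(4) by (auto simp: S_def blk_def less_mult_imp_div_less)
    then show ?thesis by (simp only: sum.empty dvd_0_right)
  qed
  define c where "c i = (\<Sum>s | s \<in> S \<and> blk s = i. W s) div p" for i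
  have c: "(\<Sum>s | s \<in> S \<and> blk s = i. W s) = p * c i" for i
    unfolding c_def using dvd_blk[of i] by (simp only: dvd_mult_div_cancel)
  obtain u where u: "\<And>j s. j < p \<Longrightarrow> s \<in> S \<Longrightarrow> u j s \<in> {0, 1 :: nat}"
    "\<And>s. s \<in> S \<Longrightarrow> (\<Sum>j<p. u j s) = W s"
    "\<And>j l. j < p \<Longrightarrow> (\<Sum>s | s \<in> S \<and> fst s = l. u j s) = r l"
    "\<And>j i. j < p \<Longrightarrow> (\<Sum>s | s \<in> S \<and> blk s = i. u j s) = c i"
    using split_into_binary_layers[OF \<open>finite S\<close> W_le r c] by blast
  define \<epsilon> where "\<epsilon> j l = vec e (\<lambda>k. real (u j (l, k)))" for j l
  have mean: "(\<Sum>s\<in>T. real (W s) / real p) = real k" if "(\<Sum>s\<in>T. W s) = p * k" for T k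
    using \<open>p > 0\<close> that by (simp flip: sum_divide_distrib of_nat_sum)
  have "\<forall>j<p. \<forall>l<d. \<epsilon> j l \<in> carrier_vec e \<and> (\<forall>i<e. \<epsilon> j l $ i \<in> {0, 1})"
    using u(1) by (fastforce simp: \<epsilon>_def S_def)
  moreover have "\<forall>l<d. v l = (1 / real p) \<cdot>\<^sub>v finsum_vec TYPE(real) e (\<lambda>j. \<epsilon> j l) {0..<p}"
  proof (intro allI impI eq_vecI)
    fix l assume l: "l < d"
    have carrier: "(\<lambda>j. \<epsilon> j l) \<in> {0..<p} \<rightarrow> carrier_vec e" by (auto simp: \<epsilon>_def)
    then have dim: "finsum_vec TYPE(real) e (\<lambda>j. \<epsilon> j l) {0..<p} \<in> carrier_vec e"
      by (rule finsum_vec_closed)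
    then show "dim_vec (v l) = dim_vec ((1 / real p) \<cdot>\<^sub>v finsum_vec TYPE(real) e (\<lambda>j. \<epsilon> j l) {0..<p})"
      using v_carrier[OF l] by simp
    fix k assume "k < dim_vec ((1 / real p) \<cdot>\<^sub>v finsum_vec TYPE(real) e (\<lambda>j. \<epsilon> j l) {0..<p})"
    with dim have k: "k < e" by simp
    have "finsum_vec TYPE(real) e (\<lambda>j. \<epsilon> j l) {0..<p} $ k = (\<Sum>j<p. real (u j (l, k)))"
      using k carrier by (subst index_finsum_vec) (auto simp: \<epsilon>_def lessThan_atLeast0)
    also have "\<dots> = real (W (l, k))"
      using l k by (simp add: u(2) S_def flip: of_nat_sum)
    finally show "v l $ k = ((1 / real p) \<cdot>\<^sub>v finsum_vec TYPE(real) e (\<lambda>j. \<epsilon> j l) {0..<p}) $ k"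
      using dim k W_v[OF l k] by simp
  qed
  moreover have "\<forall>j<p. \<forall>l<d. entry_sum (\<epsilon> j l) = entry_sum (v l)"
  proof (intro allI impI)
    fix j l assume "j < p" "l < d"
    then have "entry_sum (\<epsilon> j l) = (\<Sum>s | s \<in> S \<and> fst s = l. real (u j s))"
      by (intro row) (auto simp: \<epsilon>_def)
    also have "\<dots> = real (r l)" using u(3)[OF \<open>j < p\<close>] by (simp flip: of_nat_sum)
    finally show "entry_sum (\<epsilon> j l) = entry_sum (v l)"
      using v_row[OF \<open>l < d\<close>] mean[OF r] by simp
  qed
  moreover have "\<forall>j<p. \<forall>i<\<eta>.
    sum_mat (col_block p i (mat_of_row_fun d e (\<epsilon> j))) = sum_mat (col_block p i V)"
  proof (intro allI impI)
    fix j i assume "j < p" "i < \<eta>"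
    then have "sum_mat (col_block p i (mat_of_row_fun d e (\<epsilon> j)))
        = (\<Sum>s | s \<in> S \<and> blk s = i. real (u j s))"
      by (intro block) (auto simp: \<epsilon>_def)
    also have "\<dots> = real (c i)" using u(4)[OF \<open>j < p\<close>] by (simp flip: of_nat_sum)
    finally show "sum_mat (col_block p i (mat_of_row_fun d e (\<epsilon> j))) = sum_mat (col_block p i V)"
      using V_block[OF \<open>i < \<eta>\<close>] mean[OF c] by simp
  qed
  ultimately show ?thesis by blast
qed

end
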